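(* Let $N\ge 3$ and let a regular $N$-gon (also denoted $N$) be given in standard orientation. For every integer $k$ with $1\le k<N/2$, $$\frac{hS[1]}{hS[k]}=\mathrm{scale}[k]\text{ of }N=\frac{\tan(\pi/N)}{\tan(k\pi/N)}.$$
   Context: A regular $m$-gon $P$ ($m\ge 3$) is in standard orientation if its lowest edge (the base edge) is horizontal. Write $cP$ for its center, $hP$ for its apothem, $sP$ for its side length, and $\mathrm{Mid}P=cP-(0,hP)$. For $1\le k<m/2$ the right-side and left-side star points $\mathrm{star}[k]$ of $P$ are $\mathrm{Mid}P\pm(hP\tan(k\pi/m),0)$. Tiles $S[k]$ of $N$ ($1\le k<N/2$): $S[k]$ is the regular polygon in standard orientation, with base edge on the base line of $N$, having $N$ sides if $N$ is even and $2N$ sides if $N$ is odd, whose center has $x$-coordinate equal to that of the left-side $\mathrm{star}[k]$ of $N$ minus $sN/2$, and whose right-side $\mathrm{star}[N/2-1]$ (if $N$ is even), respectively right-side $\mathrm{star}[N-2]$ (if $N$ is odd), is the left-side $\mathrm{star}[1]$ of $N$. $\mathrm{scale}[k]$ of $N$ is $\tan(\pi/N)/\tan(k\pi/N)$. *)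

theory Defs
  imports "HOL-Analysis.Analysis"
begin

text \<open>
  A polygon is the list of its vertices in the plane. A regular polygon is listed
  counterclockwise; the starting vertex is arbitrary.
\<close>

type_synonym polygon = "(real \<times> real) list"

definition regular_polygon :: "nat \<Rightarrow> polygon \<Rightarrow> bool" where
  "regular_polygon m P \<longleftrightarrow> m \<ge> 3 \<and>
     (\<exists>c r \<theta>. r > 0 \<and>
        P = map (\<lambda>j. c + r *\<^sub>R (cos (\<theta> + 2 * pi * real j / real m),
                                sin (\<theta> + 2 * pi * real j / real m))) [0..<m])"

definition center :: "polygon \<Rightarrow> real \<times> real" where
  "center P = (1 / real (length P)) *\<^sub>R sum_list P"

text \<open>
  All edges of a regular polygon are alike, so the edge joining the first two vertices serves
  to measure the side length and the apothem.
\<close>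

definition side :: "polygon \<Rightarrow> real" where
  "side P = dist (P ! 0) (P ! 1)"

definition apothem :: "polygon \<Rightarrow> real" where
  "apothem P = dist (center P) (midpoint (P ! 0) (P ! 1))"

text \<open>
  Standard orientation includes the labelling convention that the listing starts with the
  lowest edge. This is no restriction on the polygon itself (a cyclic shift of the listing
  achieves it), and it makes the list of vertices unique for each polygon.
\<close>

definition standard_orientation :: "polygon \<Rightarrow> bool" where
  "standard_orientation P \<longleftrightarrow>
     snd (P ! 0) = snd (P ! 1) \<and> (\<forall>v\<in>set P. snd (P ! 0) \<le> snd v)"

definition base_edge :: "polygon \<Rightarrow> (real \<times> real) set" where
  "base_edge P = closed_segment (P ! 0) (P ! 1)"

definition base_line :: "polygon \<Rightarrow> (real \<times> real) set" where
  "base_line P = affine hull (base_edge P)"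

definition Mid :: "polygon \<Rightarrow> real \<times> real" where
  "Mid P = center P - (0, apothem P)"

text \<open>The star points of an \<open>m\<close>-gon are meaningful for \<open>1 \<le> k < m / 2\<close>.\<close>

definition right_star :: "polygon \<Rightarrow> nat \<Rightarrow> real \<times> real" where
  "right_star P k = Mid P + (apothem P * tan (real k * pi / real (length P)), 0)"

definition left_star :: "polygon \<Rightarrow> nat \<Rightarrow> real \<times> real" where
  "left_star P k = Mid P - (apothem P * tan (real k * pi / real (length P)), 0)"

definition is_tile :: "polygon \<Rightarrow> nat \<Rightarrow> polygon \<Rightarrow> bool" where
  "is_tile N k S \<longleftrightarrow>
     regular_polygon (if even (length N) then length N else 2 * length N) S \<and>
     standard_orientation S \<and>
     base_edge S \<subseteq> base_line N \<and>
     fst (center S) = fst (left_star N k) - side N / 2 \<and>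
     right_star S (if even (length N) then length N div 2 - 1 else length N - 2) = left_star N 1"

text \<open>The tile \<open>S[k]\<close> of \<open>N\<close>, for \<open>1 \<le> k < length N / 2\<close>.\<close>

definition tile :: "polygon \<Rightarrow> nat \<Rightarrow> polygon" where
  "tile N k = (THE S. is_tile N k S)"

definition scale_of :: "polygon \<Rightarrow> nat \<Rightarrow> real" where
  "scale_of N k = tan (pi / real (length N)) / tan (real k * pi / real (length N))"

end

theory Submission
  imports Defs
begin

text \<open>
  A regular \<open>m\<close>-gon in standard orientation is determined by its center and its apothem. With
  \<open>h\<close> the apothem of the given \<open>n\<close>-gon, both prescribed points of \<open>S[k]\<close> are given by explicit
  horizontal offsets, and the distance between the foot of its apothem and its outer right star
  point comes out as \<open>h tan (k \<pi> / n)\<close>. Whether \<open>S[k]\<close> has \<open>n\<close> or \<open>2 n\<close> sides, that star point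
  belongs to the angle \<open>\<pi> / 2 - \<pi> / n\<close>, so the apothem of \<open>S[k]\<close> is
  \<open>h tan (\<pi> / n) tan (k \<pi> / n)\<close>.
\<close>

text \<open>\<open>h / cos (pi / m)\<close> is the circumradius for apothem \<open>h\<close>. Angles
  are measured counterclockwise from the downward direction, so the vertices 0 and 1, at
  \<open>-pi / m\<close> and \<open>pi / m\<close>, bound the base edge.\<close>

definition standard_ngon :: "nat \<Rightarrow> real \<times> real \<Rightarrow> real \<Rightarrow> polygon" where
  "standard_ngon m c h =
     map (\<lambda>j. c + (h / cos (pi / real m)) *\<^sub>R
           (sin ((2 * real j - 1) * pi / real m), - cos ((2 * real j - 1) * pi / real m))) [0..<m]"

section \<open>Center, apothem and side of a standard polygon\<close>

lemma cos_pi_div_pos: "m \<ge> 3 \<Longrightarrow> cos (pi / real m) > 0"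
  by (rule cos_gt_zero) (auto simp: field_simps)

lemma sin_pi_div_pos: "m \<ge> 3 \<Longrightarrow> sin (pi / real m) > 0"
  by (rule sin_gt_zero) (auto simp: field_simps)

lemma length_standard_ngon [simp]: "length (standard_ngon m c h) = m"
  by (simp add: standard_ngon_def)

lemma standard_ngon_nth:
  assumes "m \<ge> 3"
  shows "standard_ngon m c h ! 0 = c + (- (h * tan (pi / real m)), - h)"
    and "standard_ngon m c h ! 1 = c + (h * tan (pi / real m), - h)"
  using assms cos_pi_div_pos[OF assms]
  by (auto simp: standard_ngon_def tan_def)

text \<open>The terms are the m-th roots of unity rotated by \<open>-pi / m\<close>, so a geometric
  sum vanishes. Its real and imaginary parts place the centroid of the vertices at
  \<open>c\<close>.\<close>

lemma sum_cis_odd_multiples: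
  assumes "m \<ge> 2"
  shows "(\<Sum>j<m. cis ((2 * real j - 1) * pi / real m)) = 0"
proof -
  define z where "z = cis (2 * pi / real m)"
  have pow: "z ^ m = 1"
    using assms unfolding z_def Complex.DeMoivre by simp
  have "z \<noteq> 1"
  proof
    assume "z = 1"
    then have "cos (2 * pi / real m) = 1"
      by (simp add: z_def complex_eq_iff)
    moreover have "cos (2 * pi / real m) < cos 0"
      using assms by (intro cos_monotone_0_pi) (auto simp: field_simps)
    ultimately show False by simp
  qed
  with pow have "(\<Sum>j<m. z ^ j) = 0"
    by (simp add: geometric_sum)
  moreover have "cis ((2 * real j - 1) * pi / real m) = cis (- pi / real m) * z ^ j" for j
    unfolding z_def Complex.DeMoivre cis_mult
    by (rule arg_cong[of _ _ cis]) (use assms in \<open>simp add: divide_simps left_diff_distrib\<close>)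
  ultimately show ?thesis
    by (simp flip: sum_distrib_left)
qed

lemma center_standard_ngon:
  assumes "m \<ge> 3"
  shows "center (standard_ngon m c h) = c"
proof -
  have "(\<Sum>j<m. cos ((2 * real j - 1) * pi / real m)) = 0"
       "(\<Sum>j<m. sin ((2 * real j - 1) * pi / real m)) = 0"
    using arg_cong[OF sum_cis_odd_multiples[of m], of Re]
      arg_cong[OF sum_cis_odd_multiples[of m], of Im] assms by simp_all
  then have "(\<Sum>j<m. (sin ((2 * real j - 1) * pi / real m),
      - cos ((2 * real j - 1) * pi / real m))) = (0 :: real \<times> real)"
    by (simp add: prod_eq_iff fst_sum snd_sum sum_negf)
  then have "sum_list (standard_ngon m c h) = real m *\<^sub>R c"
    by (simp add: standard_ngon_def interv_sum_list_conv_sum_set_nat atLeast0LessThan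
        sum.distrib scaleR_right.sum[symmetric] sum_constant_scaleR del: scaleR_Pair)
  with assms show ?thesis
    by (simp add: center_def)
qed

lemma apothem_standard_ngon:
  assumes "m \<ge> 3" "h > 0"
  shows "apothem (standard_ngon m c h) = h"
  using assms unfolding apothem_def center_standard_ngon[OF assms(1)] standard_ngon_nth[OF assms(1)]
  by (cases c) (simp add: midpoint_def dist_Pair_Pair dist_real_def field_simps)

lemma side_standard_ngon:
  assumes "m \<ge> 3" "h > 0"
  shows "side (standard_ngon m c h) = 2 * h * tan (pi / real m)"
proof -
  have "h * tan (pi / real m) > 0"
    using assms sin_pi_div_pos[OF assms(1)] cos_pi_div_pos[OF assms(1)] by (simp add: tan_def)
  then show ?thesis
    unfolding side_def standard_ngon_nth[OF assms(1)]
    by (cases c) (simp add: dist_Pair_Pair dist_real_def real_sqrt_mult)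
qed

section \<open>Base line, base edge and star points\<close>

lemma affine_hull_horizontal_pair:
  fixes a b y :: real
  assumes "a \<noteq> b"
  shows "affine hull {(a, y), (b, y)} = {p. snd p = y}"
proof (intro set_eqI iffI)
  fix p assume "p \<in> affine hull {(a, y), (b, y)}"
  then show "p \<in> {p. snd p = y}"
    by (auto simp: affine_hull_2 simp flip: distrib_right)
next
  fix p :: "real \<times> real" assume p: "p \<in> {p. snd p = y}"
  define v where "v = (fst p - a) / (b - a)"
  have "v * (b - a) = fst p - a"
    using assms by (simp add: v_def)
  then have "p = (1 - v) *\<^sub>R (a, y) + v *\<^sub>R (b, y)"
    using p by (cases p) (auto simp: algebra_simps)
  then show "p \<in> affine hull {(a, y), (b, y)}"
    unfolding affine_hull_2 by (intro CollectI exI[of _ "1 - v"] exI[of _ v]) simp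
qed

lemma base_line_standard_ngon:
  assumes "m \<ge> 3" "h > 0"
  shows "base_line (standard_ngon m c h) = {p. snd p = snd c - h}"
proof -
  have "tan (pi / real m) > 0"
    using sin_pi_div_pos[OF assms(1)] cos_pi_div_pos[OF assms(1)] by (simp add: tan_def)
  with \<open>h > 0\<close> show ?thesis
    using affine_hull_horizontal_pair[of "fst c - h * tan (pi / real m)"
        "fst c + h * tan (pi / real m)" "snd c - h"]
    unfolding base_line_def base_edge_def standard_ngon_nth[OF assms(1)]
      segment_convex_hull affine_hull_convex_hull
    by (cases c) simp
qed

text \<open>Turns the condition that a tile stands on the base line into a scalar equation for its
  center and apothem.\<close>

lemma base_edge_standard_ngon_subset_iff:
  assumes "m \<ge> 3"
  shows "base_edge (standard_ngon m c h) \<subseteq> {p. snd p = y} \<longleftrightarrow> snd c - h = y"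
proof
  assume "base_edge (standard_ngon m c h) \<subseteq> {p. snd p = y}"
  then show "snd c - h = y"
    unfolding base_edge_def standard_ngon_nth[OF assms] by (auto dest!: subsetD[OF _ ends_in_segment(1)])
next
  assume "snd c - h = y"
  then show "base_edge (standard_ngon m c h) \<subseteq> {p. snd p = y}"
    unfolding base_edge_def standard_ngon_nth[OF assms]
    by (cases c) (auto simp: closed_segment_def algebra_simps)
qed

lemma right_star_standard_ngon:
  assumes "m \<ge> 3" "h > 0"
  shows "right_star (standard_ngon m c h) k = c + (h * tan (real k * pi / real m), - h)"
  using assms by (cases c) (simp add: right_star_def Mid_def center_standard_ngon apothem_standard_ngon)

lemma left_star_standard_ngon:
  assumes "m \<ge> 3" "h > 0"
  shows "left_star (standard_ngon m c h) k = c - (h * tan (real k * pi / real m), h)"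
  using assms by (cases c) (simp add: left_star_def Mid_def center_standard_ngon apothem_standard_ngon)

section \<open>Standard polygons as the regular polygons in standard orientation\<close>

lemma regular_polygon_standard_ngon:
  assumes "m \<ge> 3" "h > 0"
  shows "regular_polygon m (standard_ngon m c h)"
  unfolding regular_polygon_def
proof (intro conjI exI)
  show "h / cos (pi / real m) > 0"
    using assms cos_pi_div_pos by simp
  \<comment> \<open>The shift by \<open>pi / 2\<close> turns (cos, sin) into (sin, -cos), that is,
    measures angles from the downward direction.\<close>
  have *: "- (pi / 2) - pi / real m + 2 * pi * real j / real m
      = (2 * real j - 1) * pi / real m - pi / 2" for j
    by (simp add: algebra_simps diff_divide_distrib)
  show "standard_ngon m c h = map (\<lambda>j. c + (h / cos (pi / real m)) *\<^sub>R
      (cos ((- (pi / 2) - pi / real m) + 2 * pi * real j / real m),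
       sin ((- (pi / 2) - pi / real m) + 2 * pi * real j / real m))) [0..<m]"
    unfolding * by (simp add: standard_ngon_def cos_diff sin_diff)
qed (fact assms)

text \<open>Modulo \<open>2 * pi\<close>, an odd multiple of \<open>pi / m\<close> is never closer
  to 0 than \<open>pi / m\<close>. Hence no vertex lies below the base edge.\<close>

lemma cos_odd_multiple_le:
  assumes "j < m"
  shows "cos ((2 * real j - 1) * pi / real m) \<le> cos (pi / real m)"
proof -
  have m: "real m \<ge> 1" "real j + 1 \<le> real m"
    using assms by linarith+
  show ?thesis
  \<comment> \<open>This asks whether the angle is at most \<open>pi\<close>, the range where cosine
    decreases. For \<open>j = 0\<close> the angle is \<open>-pi / m\<close> and equality
    holds.\<close>
  proof (cases "2 * j \<le> m + 1")
    case True
    then have le: "2 * real j - 1 \<le> real m" by linarith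
    show ?thesis
    proof (cases "j = 0")
      case False
      then have "1 \<le> 2 * real j - 1" by simp
      then have "pi / real m \<le> (2 * real j - 1) * pi / real m"
        by (intro divide_right_mono) auto
      moreover have "(2 * real j - 1) * pi / real m \<le> pi"
        using mult_right_mono[OF le, of pi] m by (simp add: divide_le_eq mult.commute)
      ultimately show ?thesis
        by (intro cos_monotone_0_pi_le) auto
    qed simp
  next
    case False
    then have le: "real m \<le> 2 * real j - 1" by linarith
    \<comment> \<open>Reflection keeps the cosine and moves an angle beyond \<open>pi\<close> back
      into the interval from \<open>pi / m\<close> to \<open>pi\<close>.\<close>
    define x where "x = 2 * pi - (2 * real j - 1) * pi / real m"
    have x: "x = (2 * real m - (2 * real j - 1)) * pi / real m"
      using m by (simp add: x_def field_simps)
    have "1 * pi / real m \<le> x"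
      unfolding x using m by (intro divide_right_mono mult_right_mono) auto
    moreover have "x \<le> pi"
      unfolding x using mult_right_mono[OF le, of pi] m by (simp add: field_simps)
    ultimately have "cos x \<le> cos (pi / real m)"
      by (intro cos_monotone_0_pi_le) auto
    then show ?thesis
      by (simp add: x_def cos_diff)
  qed
qed

lemma standard_orientation_standard_ngon:
  assumes "m \<ge> 3" "h > 0"
  shows "standard_orientation (standard_ngon m c h)"
proof -
  have "h / cos (pi / real m) * cos ((2 * real j - 1) * pi / real m) \<le> h" if "j < m" for j
    using cos_odd_multiple_le[OF that] cos_pi_div_pos[OF assms(1)] assms by (simp add: field_simps)
  then have "snd c - h \<le> snd v" if "v \<in> set (standard_ngon m c h)" for v
    using that by (cases c) (fastforce simp: standard_ngon_def)
  then show ?thesis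
    unfolding standard_orientation_def standard_ngon_nth[OF assms(1)] by (cases c) simp
qed

text \<open>Equal heights of the first two vertices make the first edge's apothem vertical, and
  minimality of that height makes it point down. This applies to the given polygon and to every
  candidate tile.\<close>

lemma regular_polygon_standard_orientation_obtains:
  assumes reg: "regular_polygon m P" and std: "standard_orientation P"
  obtains c h where "m \<ge> 3" "h > 0" "P = standard_ngon m c h"
proof -
  from reg obtain c r \<theta> where m: "m \<ge> 3" and r: "r > 0"
    and P: "P = map (\<lambda>j. c + r *\<^sub>R (cos (\<theta> + 2 * pi * real j / real m),
                                sin (\<theta> + 2 * pi * real j / real m))) [0..<m]"
    unfolding regular_polygon_def by blast
  \<comment> \<open>The direction from the center to the midpoint of the first edge.\<close>
  define \<phi> where "\<phi> = \<theta> + pi / real m"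
  have ang: "\<theta> + 2 * pi * real j / real m = \<phi> + (2 * real j - 1) * pi / real m" for j
    by (simp add: \<phi>_def algebra_simps diff_divide_distrib)
  have nth: "snd (P ! j) = snd c + r * sin (\<phi> + (2 * real j - 1) * pi / real m)" if "j < m" for j
    using that by (simp add: P ang)
  have "snd (P ! 0) = snd (P ! 1)"
    using std by (simp add: standard_orientation_def)
  then have "cos \<phi> * sin (pi / real m) = 0"
    using r m by (simp add: nth sin_add sin_diff)
  then have cos: "cos \<phi> = 0"
    using sin_pi_div_pos[OF m] by simp
  \<comment> \<open>The third vertex excludes the polygon listed from its highest edge.\<close>
  have "P ! 2 \<in> set P"
    using m by (intro nth_mem) (simp add: P)
  with std have "snd (P ! 0) \<le> snd (P ! 2)"
    unfolding standard_orientation_def by (elim conjE bspec)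
  then have "sin \<phi> * cos (pi / real m) \<le> sin \<phi> * cos (3 * pi / real m)"
    using r m cos by (simp add: nth sin_add sin_diff)
  \<comment> \<open>\<open>m \<ge> 3\<close> keeps \<open>3 * pi / m\<close> within
    \<open>[0, pi]\<close>; the strict inequality then rules out
    \<open>sin \<phi> = 1\<close>.\<close>
  moreover have "cos (3 * pi / real m) < cos (pi / real m)"
    using m by (intro cos_monotone_0_pi) (auto simp: field_simps)
  moreover have "sin \<phi> = 1 \<or> sin \<phi> = - 1"
    using sin_cos_squared_add[of \<phi>] cos by (simp add: power2_eq_1_iff)
  ultimately have sin: "sin \<phi> = - 1" by auto
  have "P = standard_ngon m c (r * cos (pi / real m))"
    using cos_pi_div_pos[OF m]
    by (simp add: P standard_ngon_def ang cos_add sin_add cos sin)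
  with m r cos_pi_div_pos[OF m] show ?thesis
    by (intro that[of "r * cos (pi / real m)" c]) auto
qed

section \<open>The tile and its apothem\<close>

lemma tan_tile_star:
  assumes "n \<ge> 3"
  shows "tan (real (if even n then n div 2 - 1 else n - 2) * pi
           / real (if even n then n else 2 * n)) = 1 / tan (pi / real n)"
proof -
  \<comment> \<open>Both \<open>(n / 2 - 1) * pi / n\<close> and
    \<open>(n - 2) * pi / (2 * n)\<close> equal \<open>pi / 2 - pi / n\<close>, whose tangent is the
    cotangent of \<open>pi / n\<close>.\<close>
  have "real (if even n then n div 2 - 1 else n - 2) * pi
      / real (if even n then n else 2 * n) = pi / 2 - pi / real n"
    using assms by (auto simp: field_simps of_nat_diff elim!: evenE)
  then show ?thesis
    by (simp add: tan_def cos_diff sin_diff)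
qed

lemma tile_standard_ngon:
  fixes n k :: nat
  assumes n: "n \<ge> 3" and h: "h > 0" and k: "1 \<le> k" "real k < real n / 2"
  defines "t \<equiv> \<lambda>k. tan (real k * pi / real n)"
  shows "tile (standard_ngon n c h) k =
    standard_ngon (if even n then n else 2 * n)
      (fst c - h * t k - h * t 1, snd c - h + h * t 1 * t k) (h * t 1 * t k)"
proof -
  define M where "M = (if even n then n else 2 * n)"
  define q where "q = (if even n then n div 2 - 1 else n - 2)"
  have M: "M \<ge> 3"
    using n by (simp add: M_def)
  have star: "tan (real q * pi / real M) = 1 / t 1"
    using tan_tile_star[OF n] by (simp add: q_def M_def t_def)
  have t_pos: "t j > 0" if "1 \<le> j" "real j < real n / 2" for j
    unfolding t_def using that n by (intro tan_gt_zero) (auto simp: field_simps)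
  have t1: "t 1 > 0" and tk: "t k > 0"
    using n k by (auto intro!: t_pos)
  \<comment> \<open>Solving the tile conditions for \<open>c'\<close> and \<open>h'\<close> as an
    equivalence yields both the existence and the uniqueness that \<open>THE\<close>
    requires.\<close>
  have iff: "is_tile (standard_ngon n c h) k (standard_ngon M c' h') \<longleftrightarrow>
      c' = (fst c - h * t k - h * t 1, snd c - h + h * t 1 * t k) \<and> h' = h * t 1 * t k"
    if "h' > 0" for c' h'
  proof -
    have "is_tile (standard_ngon n c h) k (standard_ngon M c' h') \<longleftrightarrow>
        snd c' - h' = snd c - h \<and>
        fst c' = fst c - h * t k - h * t 1 \<and>
        c' + (h' * (1 / t 1), - h') = c - (h * t 1, h)"
      unfolding is_tile_def length_standard_ngon M_def[symmetric] q_def[symmetric]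
        base_line_standard_ngon[OF n h] base_edge_standard_ngon_subset_iff[OF M]
        center_standard_ngon[OF M] left_star_standard_ngon[OF n h] side_standard_ngon[OF n h]
        right_star_standard_ngon[OF M that] star
      using regular_polygon_standard_ngon[OF M that] standard_orientation_standard_ngon[OF M that]
      by (simp add: t_def)
    \<comment> \<open>Subtracting the abscissa of the center from that of the star point cancels
      \<open>h * t 1\<close>, half the side of the given polygon.\<close>
    also have "\<dots> \<longleftrightarrow> snd c' - h' = snd c - h \<and>
        fst c' = fst c - h * t k - h * t 1 \<and> h' / t 1 = h * t k"
      by (cases c; cases c') auto
    also have "\<dots> \<longleftrightarrow> snd c' - h' = snd c - h \<and>
        fst c' = fst c - h * t k - h * t 1 \<and> h' = h * t 1 * t k"
      using t1 by (simp add: divide_eq_eq mult_ac)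
    finally show ?thesis
      by (cases c') auto
  qed
  have h': "h * t 1 * t k > 0"
    using h t1 tk by simp
  show ?thesis
    unfolding tile_def M_def[symmetric]
  proof (rule the_equality)
    show "is_tile (standard_ngon n c h) k (standard_ngon M
        (fst c - h * t k - h * t 1, snd c - h + h * t 1 * t k) (h * t 1 * t k))"
      using iff[OF h'] by blast
  next
    fix S assume S: "is_tile (standard_ngon n c h) k S"
    then have "regular_polygon M S" "standard_orientation S"
      unfolding is_tile_def length_standard_ngon M_def[symmetric] by (rule conjunct1, rule conjunct1[OF conjunct2])
    then obtain c' h' where h'_pos: "h' > 0" and S_eq: "S = standard_ngon M c' h'"
      by (rule regular_polygon_standard_orientation_obtains)
    show "S = standard_ngon M
        (fst c - h * t k - h * t 1, snd c - h + h * t 1 * t k) (h * t 1 * t k)"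
      using S iff[OF h'_pos] unfolding S_eq by simp
  qed
qed

lemma apothem_tile_standard_ngon:
  fixes n k :: nat
  assumes "n \<ge> 3" "h > 0" "1 \<le> k" "real k < real n / 2"
  shows "apothem (tile (standard_ngon n c h) k) = h * tan (pi / real n) * tan (real k * pi / real n)"
proof -
  have "tan (pi / real n) > 0" "tan (real k * pi / real n) > 0"
    using assms by (auto intro!: tan_gt_zero simp: field_simps)
  with assms show ?thesis
    by (subst tile_standard_ngon) (auto intro!: apothem_standard_ngon)
qed

theorem lemma3p1:
  fixes n k :: nat and N :: polygon
  assumes "n \<ge> 3"
    and "regular_polygon n N"
    and "standard_orientation N"
    and "1 \<le> k" and "real k < real n / 2"
  shows "apothem (tile N 1) / apothem (tile N k) = scale_of N k \<and>
         scale_of N k = tan (pi / real n) / tan (real k * pi / real n)"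
proof -
  from assms(2,3) obtain c h where h: "h > 0" and N: "N = standard_ngon n c h"
    by (rule regular_polygon_standard_orientation_obtains)
  \<comment> \<open>The apothems are \<open>h * t 1 * t 1\<close> and \<open>h * t 1 * t k\<close>
    with \<open>t j = tan (j * pi / n)\<close>; positivity lets the common factor
    \<open>h * t 1\<close> cancel.\<close>
  have "tan (pi / real n) > 0"
    using assms(1) by (intro tan_gt_zero) (auto simp: field_simps)
  with assms h show ?thesis
    by (simp add: N scale_of_def apothem_tile_standard_ngon)
qed

end
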